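(* For any prime power $q\equiv 1\pmod 4$, the Paley graph $P(q)$ is triply transitive if and only if $q\in\{5,9\}$.
   Context: The Paley graph $P(q)$ has vertex set $\mathbb F_q$, with $x\sim y$ iff $x-y$ is a non-zero square in $\mathbb F_q$. For a strongly regular graph $\Gamma=(V,E)$: $A_0=I$, $A_1$ its adjacency matrix, $A_2=J-I-A_1$; for a vertex $\omega$, $E^*_{i,\omega}$ ($i=0,1,2$) is the diagonal matrix whose diagonal is the $\omega$-row of $A_i$; $T_\omega$ is the algebra generated by $A_0,A_1,A_2,E^*_{0,\omega},E^*_{1,\omega},E^*_{2,\omega}$; $T_{0,\omega}$ is the span of all $E^*_{i,\omega}A_jE^*_{k,\omega}$; $\tilde T_\omega$ is the algebra of complex matrices commuting with the permutation matrices of the stabilizer $G_\omega$ in $G=\mathrm{Aut}(\Gamma)$. $\Gamma$ is triply transitive if $G$ is transitive and $T_{0,\omega}=T_\omega=\tilde T_\omega$ for some (equivalently every) vertex $\omega$. *)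

theory Defs
  imports "HOL-Analysis.Analysis" "HOL-Number_Theory.Number_Theory"
begin

text \<open>A graph on the finite vertex type \<open>'v\<close> is given by its adjacency relation.\<close>

definition simple_graph :: "('v \<Rightarrow> 'v \<Rightarrow> bool) \<Rightarrow> bool" where
  "simple_graph E \<longleftrightarrow> symp E \<and> irreflp E"

text \<open>The last two conjuncts exclude the edgeless and the complete graphs, so that
  \<open>I\<close>, \<open>A\<^sub>1\<close> and \<open>J - I - A\<^sub>1\<close> are all non-zero.\<close>

definition strongly_regular :: "('v::finite \<Rightarrow> 'v \<Rightarrow> bool) \<Rightarrow> bool" where
  "strongly_regular E \<longleftrightarrow> simple_graph E \<and>
     (\<exists>k l m. (\<forall>x. card {z. E x z} = k) \<and>
              (\<forall>x y. E x y \<longrightarrow> card {z. E x z \<and> E y z} = l) \<and>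
              (\<forall>x y. x \<noteq> y \<and> \<not> E x y \<longrightarrow> card {z. E x z \<and> E y z} = m)) \<and>
     (\<exists>x y. E x y) \<and> (\<exists>x y. x \<noteq> y \<and> \<not> E x y)"

definition graph_aut :: "('v \<Rightarrow> 'v \<Rightarrow> bool) \<Rightarrow> ('v \<Rightarrow> 'v) set" where
  "graph_aut E = {g. bij g \<and> (\<forall>x y. E (g x) (g y) \<longleftrightarrow> E x y)}"

definition vertex_stabilizer :: "('v \<Rightarrow> 'v \<Rightarrow> bool) \<Rightarrow> 'v \<Rightarrow> ('v \<Rightarrow> 'v) set" where
  "vertex_stabilizer E w = {g \<in> graph_aut E. g w = w}"

definition vertex_transitive :: "('v \<Rightarrow> 'v \<Rightarrow> bool) \<Rightarrow> bool" where
  "vertex_transitive E \<longleftrightarrow> (\<forall>x y. \<exists>g\<in>graph_aut E. g x = y)"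

definition mat_scale :: "complex \<Rightarrow> complex^'n^'m \<Rightarrow> complex^'n^'m" where
  "mat_scale c A = (\<chi> i j. c * A $ i $ j)"

text \<open>The generic \<open>span\<close> of the library type class is a real span; the complex one is
  \<open>cmat.span\<close>.\<close>

global_interpretation cmat: vector_space mat_scale
  by unfold_locales (simp_all add: mat_scale_def vec_eq_iff algebra_simps)

definition matrix_subalgebra :: "(complex^'n^'n) set \<Rightarrow> bool" where
  "matrix_subalgebra S \<longleftrightarrow>
     cmat.subspace S \<and> mat 1 \<in> S \<and> (\<forall>A\<in>S. \<forall>B\<in>S. A ** B \<in> S)"

definition perm_matrix :: "('v \<Rightarrow> 'v) \<Rightarrow> complex^'v^'v" where
  "perm_matrix g = (\<chi> x y. if x = g y then 1 else 0)"

definition adj_matrix :: "('v \<Rightarrow> 'v \<Rightarrow> bool) \<Rightarrow> complex^'v^'v" where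
  "adj_matrix E = (\<chi> x y. if E x y then 1 else 0)"

definition all_ones :: "complex^'n^'n" where
  "all_ones = (\<chi> x y. 1)"

text \<open>Only the indices \<open>0, 1, 2\<close> are meaningful here and below.\<close>

definition assoc_matrix :: "('v::finite \<Rightarrow> 'v \<Rightarrow> bool) \<Rightarrow> nat \<Rightarrow> complex^'v^'v" where
  "assoc_matrix E i =
     (if i = 0 then mat 1
      else if i = 1 then adj_matrix E
      else all_ones - mat 1 - adj_matrix E)"

definition dual_idempotent ::
    "('v::finite \<Rightarrow> 'v \<Rightarrow> bool) \<Rightarrow> 'v \<Rightarrow> nat \<Rightarrow> complex^'v^'v" where
  "dual_idempotent E w i = (\<chi> x y. if x = y then assoc_matrix E i $ w $ x else 0)"

definition terwilliger_algebra ::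
    "('v::finite \<Rightarrow> 'v \<Rightarrow> bool) \<Rightarrow> 'v \<Rightarrow> (complex^'v^'v) set" where
  "terwilliger_algebra E w =
     matrix_subalgebra hull
       (assoc_matrix E ` {0, 1, 2} \<union> dual_idempotent E w ` {0, 1, 2})"

definition terwilliger_T0 ::
    "('v::finite \<Rightarrow> 'v \<Rightarrow> bool) \<Rightarrow> 'v \<Rightarrow> (complex^'v^'v) set" where
  "terwilliger_T0 E w =
     cmat.span {dual_idempotent E w i ** assoc_matrix E j ** dual_idempotent E w k | i j k.
       i \<in> {0, 1, 2} \<and> j \<in> {0, 1, 2} \<and> k \<in> {0, 1, 2}}"

definition stabilizer_centralizer ::
    "('v::finite \<Rightarrow> 'v \<Rightarrow> bool) \<Rightarrow> 'v \<Rightarrow> (complex^'v^'v) set" where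
  "stabilizer_centralizer E w =
     {M. \<forall>g\<in>vertex_stabilizer E w. M ** perm_matrix g = perm_matrix g ** M}"

text \<open>By transitivity the choice of \<open>w\<close> is immaterial.\<close>

definition triply_transitive :: "('v::finite \<Rightarrow> 'v \<Rightarrow> bool) \<Rightarrow> bool" where
  "triply_transitive E \<longleftrightarrow>
     strongly_regular E \<and> vertex_transitive E \<and>
     (\<exists>w. terwilliger_T0 E w = terwilliger_algebra E w \<and>
          terwilliger_algebra E w = stabilizer_centralizer E w)"

text \<open>The finite field is the type \<open>'a\<close>; adjacency is symmetric when its order is
  \<open>1\<close> modulo \<open>4\<close>.\<close>

definition paley :: "'a::{field,finite} \<Rightarrow> 'a \<Rightarrow> bool" where
  "paley x y \<longleftrightarrow> x - y \<noteq> 0 \<and> (\<exists>z. x - y = z^2)"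

end

theory Submission
  imports Defs "HOL-Library.Z2"
begin

text \<open>Let \<open>\<chi>\<close> be the quadratic character and \<open>S(t) = \<Sum>z. \<chi>(z) \<chi>(z - 1) \<chi>(z - t)\<close>. If \<open>T\<^sub>0 = T\<close>, then
  \<open>A\<^sub>1 E\<^sup>*\<^sub>1 A\<^sub>1\<close> lies in \<open>T\<^sub>0\<close>, so the number of common neighbours of three vertices depends only on their
  mutual relations; hence \<open>S(t)\<close> depends only on \<open>\<chi>(t)\<close> and \<open>\<chi>(1 - t)\<close>. The identities
  \<open>S(1 - t) = S(t)\<close> and \<open>S(1/t) = \<chi>(t) S(t)\<close> leave two unknown integers, and the values of \<open>\<Sum>t. S(t)\<close> and
  \<open>\<Sum>t. S(t)\<^sup>2\<close> are compatible with integrality only for \<open>q \<in> {5, 9}\<close>; no bound on \<open>S\<close> is needed.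
  Conversely, for these \<open>q\<close> the maps \<open>z \<mapsto> a z\<close> (\<open>a\<close> a square), together with the Frobenius map
  for \<open>q = 9\<close>, are transitive on the pairs in each relation triple.\<close>

subsection \<open>Terwilliger algebras\<close>

text \<open>For irreflexive \<open>E\<close> this is the index of the association-scheme relation
  containing the pair, so each \<open>assoc_matrix E i\<close> is the indicator of one
  value.\<close>

definition graph_rel :: "('v \<Rightarrow> 'v \<Rightarrow> bool) \<Rightarrow> 'v \<Rightarrow> 'v \<Rightarrow> nat" where
  "graph_rel E x y = (if x = y then 0 else if E x y then 1 else 2)"

lemma assoc_matrix_nth:
  assumes "irreflp E" "i \<in> {0, 1, 2}"
  shows "assoc_matrix E i $ x $ y = of_bool (graph_rel E x y = i)"
  using assms
  by (auto simp: assoc_matrix_def graph_rel_def adj_matrix_def all_ones_def mat_def irreflp_def)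

lemma dual_idempotent_mult_nth:
  "(dual_idempotent E w i ** A) $ x $ y = assoc_matrix E i $ w $ x * A $ x $ y"
proof -
  have "(dual_idempotent E w i ** A) $ x $ y =
      (\<Sum>k\<in>UNIV. if k = x then assoc_matrix E i $ w $ x * A $ x $ y else 0)"
    unfolding matrix_matrix_mult_def dual_idempotent_def vec_lambda_beta by (rule sum.cong) auto
  then show ?thesis by simp
qed

lemma mult_dual_idempotent_nth:
  "(A ** dual_idempotent E w i) $ x $ y = A $ x $ y * assoc_matrix E i $ w $ y"
proof -
  have "(A ** dual_idempotent E w i) $ x $ y =
      (\<Sum>k\<in>UNIV. if k = y then A $ x $ y * assoc_matrix E i $ w $ y else 0)"
    unfolding matrix_matrix_mult_def dual_idempotent_def vec_lambda_beta by (rule sum.cong) auto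
  then show ?thesis by simp
qed

lemma T0_generator_nth:
  assumes "irreflp E" "i \<in> {0, 1, 2}" "j \<in> {0, 1, 2}" "k \<in> {0, 1, 2}"
  shows "(dual_idempotent E w i ** assoc_matrix E j ** dual_idempotent E w k) $ x $ y =
    of_bool (graph_rel E w x = i \<and> graph_rel E x y = j \<and> graph_rel E w y = k)"
  by (simp add: mult_dual_idempotent_nth dual_idempotent_mult_nth
      assoc_matrix_nth[OF assms(1,2)] assoc_matrix_nth[OF assms(1,3)] assoc_matrix_nth[OF assms(1,4)]
      flip: of_bool_conj)

lemma graph_rel_range: "graph_rel E x y \<in> {0, 1, 2}"
  by (simp add: graph_rel_def)

text \<open>The generators are the 0/1 indicators of the relation triples of
  \<open>(w, x, y)\<close> and have disjoint supports, so their span consists of the matrices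
  constant on each triple.\<close>

lemma mem_terwilliger_T0_iff:
  fixes E :: "'v::finite \<Rightarrow> 'v \<Rightarrow> bool"
  assumes "irreflp E"
  shows "M \<in> terwilliger_T0 E w \<longleftrightarrow>
    (\<forall>x y x' y'. graph_rel E w x = graph_rel E w x' \<and> graph_rel E x y = graph_rel E x' y' \<and>
       graph_rel E w y = graph_rel E w y' \<longrightarrow> M $ x $ y = M $ x' $ y')" (is "_ \<longleftrightarrow> ?inv M")
proof
  let ?G = "{dual_idempotent E w i ** assoc_matrix E j ** dual_idempotent E w k | i j k.
       i \<in> {0, 1, 2} \<and> j \<in> {0, 1, 2} \<and> k \<in> {0, 1, 2}}"
  assume M: "M \<in> terwilliger_T0 E w"
  have "cmat.span ?G \<subseteq> Collect ?inv"
  proof (rule cmat.span_minimal)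
    show "?G \<subseteq> Collect ?inv"
    proof
      fix A assume "A \<in> ?G"
      then obtain i j k where ijk: "i \<in> {0, 1, 2}" "j \<in> {0, 1, 2}" "k \<in> {0, 1, 2}"
        and A: "A = dual_idempotent E w i ** assoc_matrix E j ** dual_idempotent E w k"
        by blast
      show "A \<in> Collect ?inv"
        unfolding A mem_Collect_eq T0_generator_nth[OF assms ijk] by simp
    qed
    show "cmat.subspace (Collect ?inv)"
      unfolding cmat.subspace_def
    proof (intro conjI ballI allI)
      show "0 \<in> Collect ?inv" by simp
    next
      fix A B assume "A \<in> Collect ?inv" "B \<in> Collect ?inv"
      then show "A + B \<in> Collect ?inv"
        unfolding mem_Collect_eq vector_add_component by (intro allI impI arg_cong2[of _ _ _ _ "(+)"]) blast+
    next
      fix c A assume "A \<in> Collect ?inv"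
      then show "mat_scale c A \<in> Collect ?inv"
        unfolding mem_Collect_eq mat_scale_def vec_lambda_beta by (intro allI impI arg_cong[of _ _ "(*) c"]) blast
    qed
  qed
  then show "?inv M"
    using M unfolding terwilliger_T0_def by blast
next
  assume inv: "?inv M"
  define rel where "rel = (\<lambda>x y. (graph_rel E w x, graph_rel E x y, graph_rel E w y))"
  define P :: "(nat \<times> nat \<times> nat) set" where "P = {0, 1, 2} \<times> {0, 1, 2} \<times> {0, 1, 2}"
  \<comment> \<open>For a triple that no pair realises \<open>c p\<close> is arbitrary; this is
    harmless because \<open>gen p\<close> is then the zero matrix.\<close>
  define c where "c p = (SOME v. \<exists>x y. rel x y = p \<and> v = M $ x $ y)" for p
  define gen where "gen = (\<lambda>(i, j, k).
    dual_idempotent E w i ** assoc_matrix E j ** dual_idempotent E w k)"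
  have rel: "rel x y \<in> P" for x y
    unfolding P_def rel_def by (intro SigmaI graph_rel_range)
  have c: "c (rel x y) = M $ x $ y" for x y
    unfolding c_def
  proof (rule someI2)
    show "\<exists>x' y'. rel x' y' = rel x y \<and> M $ x $ y = M $ x' $ y'" by blast
  next
    fix v assume "\<exists>x' y'. rel x' y' = rel x y \<and> v = M $ x' $ y'"
    then obtain x' y' where "rel x' y' = rel x y" and v: "v = M $ x' $ y'" by blast
    then have "M $ x' $ y' = M $ x $ y" using inv unfolding rel_def by blast
    with v show "v = M $ x $ y" by simp
  qed
  have gen: "gen p $ x $ y = of_bool (p = rel x y)" if "p \<in> P" for p x y
  proof -
    obtain i j k where p: "p = (i, j, k)" by (cases p)
    with that have "i \<in> {0, 1, 2}" "j \<in> {0, 1, 2}" "k \<in> {0, 1, 2}" by (auto simp: P_def)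
    from T0_generator_nth[OF assms this] show ?thesis
      by (auto simp: gen_def p rel_def)
  qed
  have "M = (\<Sum>p\<in>P. mat_scale (c p) (gen p))"
  proof (unfold vec_eq_iff, intro allI)
    fix x y
    have "(\<Sum>p\<in>P. mat_scale (c p) (gen p)) $ x $ y = (\<Sum>p\<in>P. c p * (gen p $ x $ y))"
      by (simp add: sum_component mat_scale_def)
    also have "\<dots> = (\<Sum>p\<in>P. if p = rel x y then c p else 0)"
      by (intro sum.cong) (auto simp: gen)
    also have "\<dots> = c (rel x y)"
      using rel by (simp add: P_def)
    finally show "M $ x $ y = (\<Sum>p\<in>P. mat_scale (c p) (gen p)) $ x $ y"
      by (simp add: c)
  qed
  also have "\<dots> \<in> terwilliger_T0 E w"
    unfolding terwilliger_T0_def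
  proof (rule cmat.span_sum, rule cmat.span_scale, rule cmat.span_base)
    fix p assume "p \<in> P"
    then show "gen p \<in> {dual_idempotent E w i ** assoc_matrix E j ** dual_idempotent E w k | i j k.
       i \<in> {0, 1, 2} \<and> j \<in> {0, 1, 2} \<and> k \<in> {0, 1, 2}}"
      unfolding P_def gen_def by (elim SigmaE, simp only: prod.case) blast
  qed
  finally show "M \<in> terwilliger_T0 E w" .
qed

section \<open>Matrices commuting with the vertex stabilizer\<close>

lemma mult_perm_matrix_nth: "(M ** perm_matrix g) $ x $ y = M $ x $ g y"
proof -
  have "(M ** perm_matrix g) $ x $ y = (\<Sum>k\<in>UNIV. if k = g y then M $ x $ g y else 0)"
    unfolding matrix_matrix_mult_def perm_matrix_def vec_lambda_beta by (rule sum.cong) auto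
  then show ?thesis by simp
qed

lemma perm_matrix_mult_nth:
  assumes "inj g"
  shows "(perm_matrix g ** M) $ g x $ y = M $ x $ y"
proof -
  have "(perm_matrix g ** M) $ g x $ y = (\<Sum>k\<in>UNIV. if k = x then M $ x $ y else 0)"
    unfolding matrix_matrix_mult_def perm_matrix_def vec_lambda_beta
    by (rule sum.cong) (auto dest: injD[OF assms])
  then show ?thesis by simp
qed

text \<open>Comparing the two products at the entry \<open>(g x, y)\<close>, which avoids the
  inverse of \<open>g\<close>, turns commutation into constancy on the orbits of pairs.\<close>

lemma mem_stabilizer_centralizer_iff:
  "M \<in> stabilizer_centralizer E w \<longleftrightarrow>
     (\<forall>g\<in>vertex_stabilizer E w. \<forall>x y. M $ g x $ g y = M $ x $ y)"
proof -
  have "M ** perm_matrix g = perm_matrix g ** M \<longleftrightarrow> (\<forall>x y. M $ g x $ g y = M $ x $ y)"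
    if "g \<in> vertex_stabilizer E w" for g
  proof -
    have g: "bij g" using that by (simp add: vertex_stabilizer_def graph_aut_def)
    then have "M ** perm_matrix g = perm_matrix g ** M \<longleftrightarrow>
      (\<forall>x y. (M ** perm_matrix g) $ g x $ y = (perm_matrix g ** M) $ g x $ y)"
      unfolding vec_eq_iff by (metis bij_pointE)
    then show ?thesis
      by (simp add: mult_perm_matrix_nth perm_matrix_mult_nth[OF bij_is_inj[OF g]])
  qed
  then show ?thesis by (simp add: stabilizer_centralizer_def)
qed

section \<open>Inclusions among the three algebras\<close>

lemma graph_rel_aut:
  assumes "g \<in> graph_aut E"
  shows "graph_rel E (g x) (g y) = graph_rel E x y"
  using assms by (auto simp: graph_aut_def graph_rel_def bij_def inj_def)

lemma matrix_subalgebra_stabilizer_centralizer: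
  "matrix_subalgebra (stabilizer_centralizer E w)"
  unfolding matrix_subalgebra_def cmat.subspace_def
proof (intro conjI ballI allI)
  show "0 \<in> stabilizer_centralizer E w"
    by (simp add: mem_stabilizer_centralizer_iff)
  show "mat 1 \<in> stabilizer_centralizer E w"
    by (simp add: stabilizer_centralizer_def)
next
  fix A B assume AB: "A \<in> stabilizer_centralizer E w" "B \<in> stabilizer_centralizer E w"
  then show "A ** B \<in> stabilizer_centralizer E w"
    unfolding stabilizer_centralizer_def mem_Collect_eq by (metis matrix_mul_assoc)
  show "A + B \<in> stabilizer_centralizer E w"
    using AB by (simp add: mem_stabilizer_centralizer_iff)
next
  fix c A assume "A \<in> stabilizer_centralizer E w"
  then show "mat_scale c A \<in> stabilizer_centralizer E w"
    by (simp add: mem_stabilizer_centralizer_iff mat_scale_def)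
qed

text \<open>The centralizer is itself a subalgebra, so only the generators need checking; their
  entries are determined by relations among \<open>w\<close>, \<open>x\<close>, \<open>y\<close>,
  which automorphisms fixing \<open>w\<close> preserve.\<close>

lemma terwilliger_algebra_subset_centralizer:
  assumes "irreflp E"
  shows "terwilliger_algebra E w \<subseteq> stabilizer_centralizer E w"
  unfolding terwilliger_algebra_def
proof (rule hull_minimal)
  show "assoc_matrix E ` {0, 1, 2} \<union> dual_idempotent E w ` {0, 1, 2} \<subseteq> stabilizer_centralizer E w"
  proof
    fix M assume "M \<in> assoc_matrix E ` {0, 1, 2} \<union> dual_idempotent E w ` {0, 1, 2}"
    then obtain i where i: "i \<in> {0, 1, 2}"
      and M: "M = assoc_matrix E i \<or> M = dual_idempotent E w i" by blast
    show "M \<in> stabilizer_centralizer E w"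
      unfolding mem_stabilizer_centralizer_iff
    proof (intro ballI allI)
      fix g x y assume "g \<in> vertex_stabilizer E w"
      then have g: "g \<in> graph_aut E" and w: "g w = w" by (auto simp: vertex_stabilizer_def)
      have "g x = g y \<longleftrightarrow> x = y" using g by (auto simp: graph_aut_def bij_def inj_def)
      then show "M $ g x $ g y = M $ x $ y"
        using M graph_rel_aut[OF g, of w x] w
        by (auto simp: dual_idempotent_def assoc_matrix_nth[OF assms i] graph_rel_aut[OF g])
    qed
  qed
qed (rule matrix_subalgebra_stabilizer_centralizer)

lemma matrix_subalgebra_terwilliger_algebra: "matrix_subalgebra (terwilliger_algebra E w)"
  unfolding terwilliger_algebra_def
proof (rule hull_in)
  fix T :: "(complex^'a^'a) set set" assume T: "\<forall>S\<in>T. matrix_subalgebra S"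
  then have "cmat.subspace (\<Inter>T)"
    by (intro cmat.subspace_Inter) (simp add: matrix_subalgebra_def)
  with T show "matrix_subalgebra (\<Inter>T)"
    by (simp add: matrix_subalgebra_def)
qed

lemma generators_in_terwilliger_algebra:
  assumes "i \<in> {0, 1, 2}"
  shows "assoc_matrix E i \<in> terwilliger_algebra E w"
    and "dual_idempotent E w i \<in> terwilliger_algebra E w"
  unfolding terwilliger_algebra_def using assms by (intro hull_inc; blast)+

lemma terwilliger_T0_subset_algebra: "terwilliger_T0 E w \<subseteq> terwilliger_algebra E w"
  unfolding terwilliger_T0_def
proof (rule cmat.span_minimal)
  have mult: "A ** B \<in> terwilliger_algebra E w"
    if "A \<in> terwilliger_algebra E w" "B \<in> terwilliger_algebra E w" for A B
    using that matrix_subalgebra_terwilliger_algebra[of E w] by (auto simp: matrix_subalgebra_def)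
  show "{dual_idempotent E w i ** assoc_matrix E j ** dual_idempotent E w k | i j k.
       i \<in> {0, 1, 2} \<and> j \<in> {0, 1, 2} \<and> k \<in> {0, 1, 2}} \<subseteq> terwilliger_algebra E w"
    using generators_in_terwilliger_algebra[of _ E w] by (blast intro: mult)
  show "cmat.subspace (terwilliger_algebra E w)"
    using matrix_subalgebra_terwilliger_algebra[of E w] by (simp add: matrix_subalgebra_def)
qed

text \<open>The \<open>(x, y)\<close> entry of \<open>M\<close> counts the common neighbours of
  \<open>w\<close>, \<open>x\<close> and \<open>y\<close>, and membership in
  \<open>terwilliger_T0\<close> makes it a function of the relation triple.\<close>

lemma triply_regular_count:
  fixes E :: "'v::finite \<Rightarrow> 'v \<Rightarrow> bool"
  assumes E: "simple_graph E" and T: "terwilliger_T0 E w = terwilliger_algebra E w"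
    and rel: "graph_rel E w x = graph_rel E w x'" "graph_rel E x y = graph_rel E x' y'"
      "graph_rel E w y = graph_rel E w y'"
  shows "card {z. E w z \<and> E x z \<and> E y z} = card {z. E w z \<and> E x' z \<and> E y' z}"
proof -
  have irr: "irreflp E" and sym: "E y z \<longleftrightarrow> E z y" for y z
    using E by (auto simp: simple_graph_def symp_def)
  define M where "M = assoc_matrix E 1 ** (dual_idempotent E w 1 ** assoc_matrix E 1)"
  have "M \<in> terwilliger_algebra E w"
    using matrix_subalgebra_terwilliger_algebra[of E w] generators_in_terwilliger_algebra[of 1 E w]
    by (simp add: M_def matrix_subalgebra_def)
  then have inv: "M $ x $ y = M $ x' $ y'"
    using mem_terwilliger_T0_iff[OF irr, of M w] T rel by blast
  have M: "M $ x $ y = of_nat (card {z. E w z \<and> E x z \<and> E y z})" for x y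
  proof -
    have "M $ x $ y = (\<Sum>z\<in>UNIV. of_bool (E w z \<and> E x z \<and> E y z))"
      unfolding M_def matrix_matrix_mult_def[of "assoc_matrix E 1"] vec_lambda_beta
        dual_idempotent_mult_nth
      by (intro sum.cong) (auto simp: assoc_matrix_def adj_matrix_def sym)
    then show ?thesis by (simp add: Groups_Big.sum_of_bool_eq)
  qed
  show ?thesis using inv unfolding M by simp
qed

text \<open>If the stabilizer is transitive on the pairs in each relation triple, then even the
  largest of the three algebras lies in the smallest.\<close>

lemma triply_transitiveI:
  fixes E :: "'v::finite \<Rightarrow> 'v \<Rightarrow> bool"
  assumes "strongly_regular E" "vertex_transitive E"
    and orbits: "\<And>x y x' y'. \<lbrakk>graph_rel E w x = graph_rel E w x'; graph_rel E x y = graph_rel E x' y';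
      graph_rel E w y = graph_rel E w y'\<rbrakk> \<Longrightarrow> \<exists>g\<in>vertex_stabilizer E w. g x = x' \<and> g y = y'"
  shows "triply_transitive E"
proof -
  have irr: "irreflp E" using assms(1) by (simp add: strongly_regular_def simple_graph_def)
  have "stabilizer_centralizer E w \<subseteq> terwilliger_T0 E w"
  proof
    fix M assume M: "M \<in> stabilizer_centralizer E w"
    show "M \<in> terwilliger_T0 E w"
      unfolding mem_terwilliger_T0_iff[OF irr]
    proof (intro allI impI, elim conjE)
      fix x y x' y'
      assume "graph_rel E w x = graph_rel E w x'" "graph_rel E x y = graph_rel E x' y'"
        "graph_rel E w y = graph_rel E w y'"
      then obtain g where "g \<in> vertex_stabilizer E w" "g x = x'" "g y = y'"
        using orbits by blast
      with M show "M $ x $ y = M $ x' $ y'"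
        unfolding mem_stabilizer_centralizer_iff by metis
    qed
  qed
  with terwilliger_T0_subset_algebra[of E w] terwilliger_algebra_subset_centralizer[OF irr, of w]
  have "terwilliger_T0 E w = terwilliger_algebra E w \<and>
      terwilliger_algebra E w = stabilizer_centralizer E w" by blast
  with assms show ?thesis unfolding triply_transitive_def by blast
qed

subsection \<open>The quadratic character\<close>

definition quad_char :: "'a::field \<Rightarrow> int" where
  "quad_char x = (if x = 0 then 0 else if \<exists>z. x = z^2 then 1 else -1)"

lemma quad_char_eq_0_iff [simp]: "quad_char x = 0 \<longleftrightarrow> x = 0"
  by (simp add: quad_char_def)

lemma quad_char_cases: "x = 0 \<or> quad_char x = 1 \<or> quad_char x = -1"
  by (simp add: quad_char_def)

lemma quad_char_power2: "x \<noteq> 0 \<Longrightarrow> quad_char (x^2) = 1"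
  unfolding quad_char_def by (metis zero_eq_power2)

lemma quad_char_0 [simp]: "quad_char 0 = 0"
  by simp

lemma quad_char_1 [simp]: "quad_char 1 = 1"
  using quad_char_power2[of 1] by simp

lemma quad_char_square: "x \<noteq> 0 \<Longrightarrow> quad_char x * quad_char x = 1"
  using quad_char_cases[of x] by (elim disjE) simp_all

lemma paley_iff: "paley x y \<longleftrightarrow> quad_char (x - y) = 1"
  by (auto simp: paley_def quad_char_def)

text \<open>Summing 1 over \<open>X\<close> in the field with two elements, a fixed-point-free
  involution cancels the terms in pairs.\<close>

lemma even_card_involution:
  assumes "\<And>x. x \<in> X \<Longrightarrow> h x \<in> X" "\<And>x. x \<in> X \<Longrightarrow> h (h x) = x" "\<And>x. x \<in> X \<Longrightarrow> h x \<noteq> x"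
  shows "even (card X)"
proof -
  have "(of_nat (card X) :: bit) = (\<Sum>x\<in>X. 1)" by simp
  also have "\<dots> = 0"
    by (rule sum_involution_eq_0[where h = h]) (use assms in auto)
  finally have "(of_nat (card X) :: bit) = 0" .
  moreover have "(of_nat n :: bit) = 0 \<longleftrightarrow> even n" for n
    by (induction n) auto
  ultimately show ?thesis by blast
qed

text \<open>Translation by 1 permutes the field, so adding 1 to every element leaves the sum of all
  elements unchanged.\<close>

lemma of_nat_card_field: "of_nat CARD('a) = (0 :: 'a::{field,finite})"
proof -
  have "(\<Sum>x\<in>UNIV. x + 1) = (\<Sum>x\<in>UNIV. x :: 'a)"
    by (rule sum.reindex_bij_witness[of _ "\<lambda>x. x - 1" "\<lambda>x. x + 1"]) auto
  then show ?thesis by (simp add: sum.distrib)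
qed

context
  assumes card_mod_4: "CARD('a::{field,finite}) mod 4 = 1"
begin

lemma two_neq_0: "(2::'a) \<noteq> 0"
proof
  assume two: "(2::'a) = 0"
  obtain m where "CARD('a) = 4 * m + 1"
    using card_mod_4 by (metis mult_div_mod_eq)
  then have "of_nat CARD('a) = (2 * 2 * of_nat m + 1 :: 'a)" by simp
  then show False unfolding two of_nat_card_field by simp
qed

lemma uminus_eq_iff: "- x = x \<longleftrightarrow> x = (0::'a)"
proof
  assume "- x = x"
  then have "2 * x = 0" by (metis add.left_inverse mult_2)
  then show "x = 0" using two_neq_0 by simp
qed simp

text \<open>Squaring is two-to-one from the non-zero elements onto the non-zero squares, since
  \<open>z\<close> and \<open>- z\<close> differ.\<close>

lemma card_quad_char_1: "2 * card {x::'a. quad_char x = 1} = CARD('a) - 1"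
proof -
  define S where "S = {x::'a. quad_char x = 1}"
  have "UNIV - {0::'a} = (\<Union>s\<in>S. {x. x^2 = s})"
    unfolding S_def using quad_char_power2 by auto
  then have "card (UNIV - {0::'a}) = card (\<Union>s\<in>S. {x. x^2 = s})" by simp
  also have "\<dots> = (\<Sum>s\<in>S. card {x. x^2 = s})"
    by (rule card_UN_disjoint) auto
  also have "\<dots> = (\<Sum>s\<in>S. 2)"
  proof (rule sum.cong)
    fix s assume "s \<in> S"
    then obtain z where z: "z \<noteq> 0" "s = z^2"
      by (auto simp: S_def quad_char_def split: if_splits)
    then have "{x. x^2 = s} = {z, - z}" by (auto simp: power2_eq_iff)
    moreover have "z \<noteq> - z" using uminus_eq_iff[of z] z by metis
    ultimately show "card {x. x^2 = s} = 2" by simp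
  qed simp
  finally show ?thesis by (simp add: S_def card_Diff_singleton)
qed

lemma card_quad_char_minus_1: "2 * card {x::'a. quad_char x = -1} = CARD('a) - 1"
proof -
  have "UNIV - {0::'a} = {x. quad_char x = 1} \<union> {x. quad_char x = -1}"
    using quad_char_cases by auto
  then have "card (UNIV - {0::'a}) = card ({x::'a. quad_char x = 1} \<union> {x. quad_char x = -1})"
    by simp
  also have "\<dots> = card {x::'a. quad_char x = 1} + card {x::'a. quad_char x = -1}"
    by (rule card_Un_disjoint) auto
  finally show ?thesis using card_quad_char_1 by (simp add: card_Diff_singleton)
qed

lemma quad_char_mult_square:
  assumes "quad_char x = 1"
  shows "quad_char (x * y) = quad_char (y::'a)"
proof -
  obtain z where z: "z \<noteq> 0" "x = z^2"
    using assms by (auto simp: quad_char_def split: if_splits)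
  have "(\<exists>w. x * y = w^2) \<longleftrightarrow> (\<exists>w. y = w^2)"
  proof
    assume "\<exists>w. x * y = w^2"
    then obtain w where "x * y = w^2" ..
    then have "y = (w / z)^2" using z by (simp add: power_divide field_simps)
    then show "\<exists>w. y = w^2" ..
  next
    assume "\<exists>w. y = w^2"
    then show "\<exists>w. x * y = w^2" using z by (metis power_mult_distrib)
  qed
  with z show ?thesis by (simp add: quad_char_def)
qed

lemma quad_char_mult: "quad_char (x * y) = quad_char x * quad_char (y::'a)"
proof -
  consider "x = 0 \<or> y = 0" | "quad_char x = 1" | "quad_char y = 1"
    | "x \<noteq> 0" "quad_char x = -1" "quad_char y = -1"
    using quad_char_cases by metis
  then show ?thesis
  proof cases
    case 2 then show ?thesis using quad_char_mult_square[of x y] by simp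
  next
    case 3 then show ?thesis using quad_char_mult_square[of y x] by (simp add: mult.commute[of x y])
  next
    case 4
    \<comment> \<open>Multiplication by \<open>x\<close> maps the squares injectively into the equally many non-squares,
      hence onto them.\<close>
    let ?S = "{x::'a. quad_char x = 1}" and ?N = "{x::'a. quad_char x = -1}"
    have "(*) x ` ?S = ?N"
    proof (rule card_subset_eq)
      show "(*) x ` ?S \<subseteq> ?N"
        using quad_char_mult_square[of _ x] 4 by (auto simp: mult.commute)
      have "card ((*) x ` ?S) = card ?S"
        using 4 by (intro card_image) (auto simp: inj_on_def)
      then show "card ((*) x ` ?S) = card ?N"
        using card_quad_char_1 card_quad_char_minus_1 by simp
    qed simp
    then obtain s where s: "quad_char s = 1" "y = x * s" using 4 by blast
    then have "quad_char (x * y) = quad_char (s * x^2)"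
      by (simp add: power2_eq_square ac_simps)
    also have "\<dots> = 1"
      using quad_char_mult_square[OF s(1)] quad_char_power2[OF 4(1)] by simp
    finally show ?thesis using 4 by simp
  qed auto
qed

lemma quad_char_inverse [simp]: "quad_char (inverse x) = quad_char (x::'a)"
proof (cases "x = 0")
  case False
  then have "quad_char x * quad_char (inverse x) = 1"
    by (simp flip: quad_char_mult)
  then show ?thesis using False quad_char_cases[of x] by auto
qed simp

lemma quad_char_divide: "quad_char (x / y) = quad_char x * quad_char (y::'a)"
  by (simp add: divide_inverse quad_char_mult)

text \<open>Otherwise inversion would pair off the squares other than \<open>1\<close>, an odd number of elements.\<close>

lemma quad_char_neg_1: "quad_char (-1::'a) = 1"
proof (rule ccontr)
  assume *: "quad_char (-1::'a) \<noteq> 1"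
  let ?S = "{x::'a. quad_char x = 1}"
  have "even (card (?S - {1}))"
  proof (rule even_card_involution[where h = inverse])
    fix x assume x: "x \<in> ?S - {1}"
    then have "x \<noteq> 0" "x \<noteq> 1" "x \<noteq> -1" using * by auto
    then show "inverse x \<noteq> x"
      using square_eq_1_iff[of x] by (metis right_inverse)
  qed auto
  \<comment> \<open>Subtraction on naturals truncates, so the parity of \<open>card ?S\<close> can
    be read off only once \<open>?S\<close> is known to be non-empty.\<close>
  moreover have "card (?S - {1}) = card ?S - 1" "card ?S \<noteq> 0"
    by (subst card_Diff_singleton) (auto simp: card_eq_0_iff intro: exI[of _ 1])
  ultimately have "odd (card ?S)"
    by simp
  \<comment> \<open>The congruence modulo 4 enters here: half of \<open>CARD('a) - 1\<close> is
    even.\<close>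
  moreover have "even (card ?S)"
    using card_quad_char_1 card_mod_4 by presburger
  ultimately show False by blast
qed

lemma quad_char_uminus [simp]: "quad_char (- x) = quad_char (x::'a)"
  using quad_char_mult[of "-1" x] quad_char_neg_1 by simp

lemma quad_char_diff_commute: "quad_char (x - y) = quad_char (y - x :: 'a)"
  by (metis minus_diff_eq quad_char_uminus)

lemma ex_quad_char_minus_1: "\<exists>n::'a. quad_char n = -1"
proof -
  have "card {0::'a, 1} \<le> CARD('a)" by (intro card_mono) auto
  then have "card {x::'a. quad_char x = -1} \<noteq> 0"
    using card_quad_char_minus_1 by (intro notI) simp
  then show ?thesis by (auto simp: card_eq_0_iff)
qed

subsection \<open>Character sums\<close>

text \<open>Multiplication by a non-square permutes the field and flips the sign of every
  term.\<close>

lemma sum_quad_char: "(\<Sum>x\<in>UNIV. quad_char (x::'a)) = 0"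
proof -
  obtain n :: 'a where n: "quad_char n = -1" using ex_quad_char_minus_1 ..
  then have "n \<noteq> 0" by auto
  then have "(\<Sum>x\<in>UNIV. quad_char (x::'a)) = (\<Sum>x\<in>UNIV. quad_char (n * x))"
    by (intro sum.reindex_bij_witness[of _ "\<lambda>x. n * x" "\<lambda>x. x / n"]) auto
  also have "\<dots> = - (\<Sum>x\<in>UNIV. quad_char (x::'a))"
    by (simp add: quad_char_mult n sum_negf)
  finally show ?thesis by simp
qed

lemma sum_quad_char_shift: "(\<Sum>x\<in>UNIV. quad_char (x - a :: 'a)) = 0"
proof -
  have "(\<Sum>x\<in>UNIV. quad_char (x - a :: 'a)) = (\<Sum>x\<in>UNIV. quad_char (x::'a))"
    by (rule sum.reindex_bij_witness[of _ "\<lambda>x. x + a" "\<lambda>x. x - a"]) auto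
  then show ?thesis by (simp add: sum_quad_char)
qed

text \<open>The substitution \<open>u = (x - b) / (x - a)\<close> turns each product into
  \<open>quad_char u\<close>, as a quotient and a product have the same character. Only
  \<open>u = 1\<close> is missed, whence the value -1.\<close>

lemma sum_quad_char_mult:
  assumes "a \<noteq> b"
  shows "(\<Sum>x\<in>UNIV. quad_char (x - a) * quad_char (x - b :: 'a)) = -1"
proof -
  have "(\<Sum>x\<in>UNIV. quad_char (x - a) * quad_char (x - b)) =
      (\<Sum>x\<in>UNIV - {a}. quad_char (x - a) * quad_char (x - b))"
    by (rule sum.mono_neutral_right) auto
  also have "\<dots> = (\<Sum>u\<in>UNIV - {1::'a}. quad_char u)"
  proof (rule sum.reindex_bij_witness[of _ "\<lambda>u. a + (a - b) / (u - 1)" "\<lambda>x. (x - b) / (x - a)"])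
    fix x assume x: "x \<in> UNIV - {a}"
    have "(x - b) / (x - a) - 1 = (a - b) / (x - a)"
      using x by (simp add: field_simps)
    then show "a + (a - b) / ((x - b) / (x - a) - 1) = x" using assms by simp
    show "(x - b) / (x - a) \<in> UNIV - {1}" using assms x by (auto simp: field_simps)
    show "quad_char ((x - b) / (x - a)) = quad_char (x - a) * quad_char (x - b)"
      by (simp add: quad_char_divide mult.commute)
  next
    fix u :: 'a assume u: "u \<in> UNIV - {1}"
    define d where "d = (a - b) / (u - 1)"
    have d: "d \<noteq> 0" "a - b = d * (u - 1)" using assms u by (auto simp: d_def)
    then have "a + d - b = d * u" by (simp add: algebra_simps)
    then show "(a + (a - b) / (u - 1) - b) / (a + (a - b) / (u - 1) - a) = u"
      using d(1) by (simp flip: d_def)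
    show "a + (a - b) / (u - 1) \<in> UNIV - {a}" using assms u by auto
  qed
  also have "\<dots> = -1"
    using sum_quad_char by (simp add: sum_diff1)
  finally show ?thesis .
qed

lemma sum_quad_char_mult_eq:
  "(\<Sum>t\<in>UNIV. quad_char (z - t) * quad_char (w - t :: 'a)) = (if z = w then int CARD('a) - 1 else -1)"
proof (cases "z = w")
  case True
  have "(\<Sum>t\<in>UNIV. quad_char (w - t) * quad_char (w - t)) = (\<Sum>t\<in>UNIV - {w}. 1)"
    by (rule sum.mono_neutral_cong_right) (auto simp: quad_char_square)
  with True show ?thesis by (simp add: card_Diff_singleton of_nat_diff)
next
  case False
  then show ?thesis
    using sum_quad_char_mult[of z w] by (simp add: quad_char_diff_commute[of z] quad_char_diff_commute[of w])
qed

text \<open>For \<open>t\<close> other than 0 and 1 this is minus the Frobenius trace of the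
  Legendre curve \<open>y^2 = z * (z - 1) * (z - t)\<close>.\<close>

definition cubic_sum :: "'a \<Rightarrow> int" where
  "cubic_sum t = (\<Sum>z\<in>UNIV. quad_char z * quad_char (z - 1) * quad_char (z - t))"

section \<open>Symmetries and moments of the cubic sum\<close>

lemma sum_quad_char_mult_pred: "(\<Sum>z\<in>UNIV. quad_char z * quad_char (z - 1 :: 'a)) = -1"
  using sum_quad_char_mult[of 0 1] by simp

text \<open>The factor \<open>quad_char z\<close> occurs squared, so what remains is the full sum of
  \<open>quad_char (z - 1)\<close> without its term at \<open>z = 0\<close>, which is 1.\<close>

lemma cubic_sum_0: "cubic_sum 0 = -1"
proof -
  have "cubic_sum 0 = (\<Sum>z\<in>UNIV - {0::'a}. quad_char (z - 1))"
    unfolding cubic_sum_def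
    by (rule sum.mono_neutral_cong_right) (auto simp: quad_char_square ac_simps)
  then show ?thesis using sum_quad_char_shift[of 1] by (simp add: sum_diff1)
qed

lemma cubic_sum_1: "cubic_sum 1 = -1"
proof -
  have "cubic_sum 1 = (\<Sum>z\<in>UNIV - {1::'a}. quad_char z)"
    unfolding cubic_sum_def
    by (rule sum.mono_neutral_cong_right) (auto simp: quad_char_square mult.assoc)
  then show ?thesis using sum_quad_char by (simp add: sum_diff1)
qed

text \<open>Replacing \<open>z\<close> by \<open>1 - z\<close> swaps the first two factors and
  negates all three arguments, which \<open>quad_char\<close> ignores.\<close>

lemma cubic_sum_reflect: "cubic_sum (1 - t) = cubic_sum t"
  unfolding cubic_sum_def
proof (rule sum.reindex_bij_witness[of _ "\<lambda>z. 1 - z" "\<lambda>z. 1 - z"])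
  fix z :: 'a
  show "quad_char (1 - z) * quad_char (1 - z - 1) * quad_char (1 - z - t) =
      quad_char z * quad_char (z - 1) * quad_char (z - (1 - t))"
    using quad_char_uminus[of z] quad_char_diff_commute[of z 1] quad_char_diff_commute[of z "1 - t"]
    by (simp add: algebra_simps del: quad_char_uminus)
qed auto

text \<open>Rescaling \<open>z\<close> by \<open>t\<close> extracts \<open>quad_char t\<close> from
  each of the three factors, and the cube of a sign is that sign.\<close>

lemma cubic_sum_inverse:
  assumes "t \<noteq> 0"
  shows "cubic_sum (inverse t) = quad_char t * cubic_sum t"
  unfolding cubic_sum_def sum_distrib_left
proof (rule sum.reindex_bij_witness[of _ "\<lambda>z. z / t" "\<lambda>z. z * t"])
  fix z :: 'a
  have "z * t - 1 = t * (z - inverse t)" "z * t - t = t * (z - 1)"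
    using assms by (simp_all add: field_simps)
  then show "quad_char t * (quad_char (z * t) * quad_char (z * t - 1) * quad_char (z * t - t)) =
      quad_char z * quad_char (z - 1) * quad_char (z - inverse t)"
    using quad_char_square[OF assms] by (simp add: quad_char_mult)
qed (use assms in auto)

lemma sum_cubic_sum: "(\<Sum>t\<in>UNIV. cubic_sum t) = 0"
proof -
  have "(\<Sum>t\<in>UNIV. cubic_sum t) =
      (\<Sum>z\<in>UNIV. quad_char z * quad_char (z - 1) * (\<Sum>t\<in>UNIV. quad_char (z - t :: 'a)))"
    unfolding cubic_sum_def sum_distrib_left by (rule sum.swap)
  also have "\<dots> = 0"
    using sum_quad_char_shift by (simp add: quad_char_diff_commute)
  finally show ?thesis .
qed

text \<open>Expand the square and sum over \<open>t\<close> first. By orthogonality of the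
  translated characters the result is q times the sum of \<open>c z * c z\<close>, minus the square
  of the sum of \<open>c z\<close>, that is \<open>q * (q - 2) - 1\<close> for a field of order
  q.\<close>

lemma sum_cubic_sum_square:
  "(\<Sum>t\<in>UNIV. (cubic_sum t)\<^sup>2) = int CARD('a) ^ 2 - 2 * int CARD('a) - 1"
proof -
  define c where "c z = quad_char z * quad_char (z - 1 :: 'a)" for z
  have "(\<Sum>t\<in>UNIV. (cubic_sum t)\<^sup>2) =
      (\<Sum>t\<in>UNIV. \<Sum>z\<in>UNIV. \<Sum>w\<in>UNIV. c z * c w * (quad_char (z - t) * quad_char (w - t :: 'a)))"
    unfolding cubic_sum_def power2_eq_square sum_product c_def by (simp add: ac_simps)
  also have "\<dots> =
      (\<Sum>z\<in>UNIV. \<Sum>t\<in>UNIV. \<Sum>w\<in>UNIV. c z * c w * (quad_char (z - t) * quad_char (w - t :: 'a)))"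
    by (rule sum.swap)
  also have "\<dots> =
      (\<Sum>z\<in>UNIV. \<Sum>w\<in>UNIV. \<Sum>t\<in>UNIV. c z * c w * (quad_char (z - t) * quad_char (w - t :: 'a)))"
    by (rule sum.cong[OF refl], rule sum.swap)
  also have "\<dots> = (\<Sum>z\<in>UNIV. \<Sum>w\<in>UNIV. (if z = w then c z * c w * int CARD('a) else 0) - c z * c w)"
    unfolding sum_distrib_left[symmetric] sum_quad_char_mult_eq
    by (intro sum.cong) (auto simp: algebra_simps)
  also have "\<dots> = (\<Sum>z\<in>UNIV. c z * c z) * int CARD('a) - (\<Sum>z\<in>UNIV. c z) * (\<Sum>w\<in>UNIV. c w)"
    by (simp add: sum_subtractf sum_product sum_distrib_right[where r = "int CARD('a)"])
  also have "(\<Sum>z\<in>UNIV. c z) = -1"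
    unfolding c_def by (rule sum_quad_char_mult_pred)
  also have "(\<Sum>z\<in>UNIV. c z * c z) = (\<Sum>z\<in>UNIV - {0, 1::'a}. 1)"
  proof (rule sum.mono_neutral_cong_right)
    fix z :: 'a assume "z \<in> UNIV - {0, 1}"
    then have "z \<noteq> 0" "z - 1 \<noteq> 0" by auto
    from this[THEN quad_char_square] show "c z * c z = 1"
      unfolding c_def by (metis mult.assoc mult.commute mult_1)
  qed (auto simp: c_def)
  also have "\<dots> = int CARD('a) - 2"
  proof -
    have "card {0::'a, 1} \<le> CARD('a)" by (intro card_mono) auto
    then show ?thesis by (simp add: card_Diff_subset of_nat_diff)
  qed
  finally show ?thesis by (simp add: algebra_simps power2_eq_square)
qed

text \<open>For signs \<open>e\<close> and \<open>d\<close> these four sets partition the field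
  without 0 and 1, according to the relations of \<open>t\<close> to the vertices 0 and 1.\<close>

definition char_class :: "int \<Rightarrow> int \<Rightarrow> 'a set" where
  "char_class e d = {t. quad_char t = e \<and> quad_char (1 - t) = d}"

lemma sum_remove_0_1:
  fixes f :: "'a \<Rightarrow> int"
  shows "(\<Sum>t\<in>UNIV. f t) = (\<Sum>t\<in>UNIV - {0, 1}. f t) + f 0 + f 1"
  by (subst sum.subset_diff[of "{0, 1}"]) auto

lemma sum_quad_char_mult_reflect: "(\<Sum>t\<in>UNIV. quad_char t * quad_char (1 - t :: 'a)) = -1"
  using sum_quad_char_mult_pred by (simp add: quad_char_diff_commute[of 1])

text \<open>Away from 0 and 1, \<open>?f\<close> is 4 on the class and 0 off it. Subtracting
  \<open>?f 0 = 1 + d\<close> and \<open>?f 1 = 1 + e\<close> from the full sum gives the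
  count.\<close>

lemma card_char_class:
  assumes "e \<in> {1, -1}" "d \<in> {1, -1}"
  shows "4 * int (card (char_class e d)) = int CARD('a) - 2 - e - d - e * d"
proof -
  let ?f = "\<lambda>t::'a. (1 + e * quad_char t) * (1 + d * quad_char (1 - t))"
  have "(\<Sum>t\<in>UNIV. ?f t) = (\<Sum>t\<in>UNIV. 1 + e * quad_char (t::'a) + d * quad_char (1 - t)
      + e * d * (quad_char t * quad_char (1 - t)))"
    by (intro sum.cong) (simp_all add: algebra_simps)
  also have "\<dots> = int CARD('a) + e * (\<Sum>t\<in>UNIV. quad_char (t::'a))
      + d * (\<Sum>t\<in>UNIV. quad_char (1 - t :: 'a))
      + e * d * (\<Sum>t\<in>UNIV. quad_char t * quad_char (1 - t :: 'a))"
    unfolding sum.distrib sum_distrib_left by simp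
  also have "(\<Sum>t\<in>UNIV. quad_char (1 - t :: 'a)) = 0"
    using sum_quad_char_shift[of 1] by (simp add: quad_char_diff_commute[of 1])
  finally have "(\<Sum>t\<in>UNIV. ?f t) = int CARD('a) - e * d"
    by (simp add: sum_quad_char sum_quad_char_mult_reflect)
  moreover have "(\<Sum>t\<in>UNIV - {0, 1}. ?f t) = (\<Sum>t\<in>char_class e d. 4)"
  proof (rule sum.mono_neutral_cong_right)
    show "char_class e d \<subseteq> UNIV - {0, 1}" using assms by (auto simp: char_class_def)
    show "\<forall>t\<in>UNIV - {0, 1} - char_class e d. ?f t = 0"
    proof
      fix t :: 'a assume t: "t \<in> UNIV - {0, 1} - char_class e d"
      then have "quad_char t = 1 \<or> quad_char t = -1" "quad_char (1 - t) = 1 \<or> quad_char (1 - t) = -1"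
        using quad_char_cases[of t] quad_char_cases[of "1 - t"] by auto
      with t show "?f t = 0" using assms by (auto simp: char_class_def)
    qed
    show "?f t = 4" if "t \<in> char_class e d" for t
      using that assms by (auto simp: char_class_def)
  qed simp
  ultimately show ?thesis using sum_remove_0_1[of ?f] by simp
qed

lemma sum_char_classes:
  fixes f :: "'a \<Rightarrow> int"
  shows "(\<Sum>t\<in>UNIV - {0, 1}. f t) = sum f (char_class 1 1) + sum f (char_class 1 (-1))
    + sum f (char_class (-1) 1) + sum f (char_class (-1) (-1))"
proof -
  have "UNIV - {0, 1::'a} =
      char_class 1 1 \<union> char_class 1 (-1) \<union> char_class (-1) 1 \<union> char_class (-1) (-1)"
  proof (intro equalityI subsetI)
    fix t :: 'a assume "t \<in> UNIV - {0, 1}"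
    then show "t \<in> char_class 1 1 \<union> char_class 1 (-1) \<union> char_class (-1) 1 \<union> char_class (-1) (-1)"
      using quad_char_cases[of t] quad_char_cases[of "1 - t"] by (auto simp: char_class_def)
  qed (auto simp: char_class_def)
  moreover have "sum f (char_class 1 1 \<union> char_class 1 (-1) \<union> char_class (-1) 1 \<union> char_class (-1) (-1)) =
     sum f (char_class 1 1) + sum f (char_class 1 (-1)) + sum f (char_class (-1) 1) + sum f (char_class (-1) (-1))"
    by (subst sum.union_disjoint; (subst sum.union_disjoint)?; (subst sum.union_disjoint)?;
        force simp: char_class_def)
  ultimately show ?thesis by simp
qed

text \<open>Away from 0, 1 and \<open>t\<close>, \<open>?g\<close> is 8 times the indicator of the
  counted set. Expanded, its linear terms sum to 0, its three quadratic terms to -1 each, and its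
  cubic term to \<open>cubic_sum t\<close>.\<close>

lemma card_common_square_shifts:
  assumes t: "t \<noteq> 0" "t \<noteq> 1"
  shows "8 * int (card {z. quad_char z = 1 \<and> quad_char (z - 1) = 1 \<and> quad_char (z - t) = 1}) =
    int CARD('a) - 3 + cubic_sum t - 2 * (1 + quad_char t) - 2 * (1 + quad_char (1 - t))
    - (1 + quad_char t) * (1 + quad_char (1 - t))"
proof -
  let ?g = "\<lambda>z::'a. (1 + quad_char z) * (1 + quad_char (z - 1)) * (1 + quad_char (z - t))"
  let ?C = "{z. quad_char z = 1 \<and> quad_char (z - 1) = 1 \<and> quad_char (z - t) = 1}"
  have "(\<Sum>z\<in>UNIV. ?g z) = (\<Sum>z\<in>UNIV. 1 + quad_char z + quad_char (z - 1) + quad_char (z - t)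
      + quad_char z * quad_char (z - 1) + quad_char z * quad_char (z - t)
      + quad_char (z - 1) * quad_char (z - t) + quad_char z * quad_char (z - 1) * quad_char (z - t))"
    by (intro sum.cong) (simp_all add: algebra_simps)
  also have "\<dots> = int CARD('a) - 3 + cubic_sum t"
    using t sum_quad_char_mult[of 0 t] sum_quad_char_mult[of 1 t]
    unfolding sum.distrib cubic_sum_def
    by (simp add: sum_quad_char sum_quad_char_shift sum_quad_char_mult_pred)
  finally have "(\<Sum>z\<in>UNIV. ?g z) = int CARD('a) - 3 + cubic_sum t" .
  moreover have "(\<Sum>z\<in>UNIV. ?g z) = (\<Sum>z\<in>UNIV - {0, 1, t}. ?g z) + (?g 0 + ?g 1 + ?g t)"
    using t by (subst sum.subset_diff[of "{0, 1, t}"]) auto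
  moreover have "(\<Sum>z\<in>UNIV - {0, 1, t}. ?g z) = (\<Sum>z\<in>?C. 8)"
  proof (rule sum.mono_neutral_cong_right)
    show "\<forall>z\<in>UNIV - {0, 1, t} - ?C. ?g z = 0"
    proof
      fix z assume z: "z \<in> UNIV - {0, 1, t} - ?C"
      then show "?g z = 0"
        using quad_char_cases[of z] quad_char_cases[of "z - 1"] quad_char_cases[of "z - t"] by auto
    qed
  qed auto
  moreover have "?g 0 = 2 * (1 + quad_char t)" "?g 1 = 2 * (1 + quad_char (1 - t))"
    "?g t = (1 + quad_char t) * (1 + quad_char (1 - t))"
    using quad_char_neg_1 by (simp_all add: quad_char_diff_commute[of t 1])
  moreover have "(\<Sum>z\<in>?C. 8) = 8 * int (card ?C)" by simp
  ultimately show ?thesis by linarith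
qed

lemma card_field_ge_5: "CARD('a) \<ge> 5"
proof -
  have "card {0::'a, 1} \<le> CARD('a)" by (intro card_mono) auto
  then have "CARD('a) \<ge> 2" by simp
  then show ?thesis using card_mod_4 by presburger
qed

text \<open>The symmetries \<open>t \<mapsto> 1 - t\<close> and \<open>t \<mapsto> 1/t\<close> leave only two unknown units \<open>a\<close> and \<open>b\<close>, and the
  first two moments of \<open>cubic_sum\<close> give two equations for them.\<close>

lemma cubic_sum_constant_on_classes:
  assumes const: "\<And>e d t t'. t \<in> char_class e d \<Longrightarrow> t' \<in> char_class e d \<Longrightarrow>
      e \<in> {1, -1} \<Longrightarrow> d \<in> {1, -1} \<Longrightarrow> cubic_sum t = cubic_sum t'"
  shows "CARD('a) \<in> {5, 9}"
proof (cases "CARD('a) = 5")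
  case False
  obtain n where "CARD('a) = 4 * n + 1"
    using card_mod_4 by (metis mult_div_mod_eq)
  \<comment> \<open>\<open>m\<close> is the size of \<open>char_class 1 1\<close>, and the other
    three classes have size \<open>m + 1\<close>. Excluding order 5 makes \<open>m\<close> positive,
    so every class has a representative.\<close>
  define m where "m = int n - 1"
  have q: "int CARD('a) = 4 * m + 5"
    unfolding m_def using \<open>CARD('a) = 4 * n + 1\<close> by simp
  then have m: "m \<ge> 1" using False card_field_ge_5 by linarith
  have card: "int (card (char_class 1 1)) = m" "int (card (char_class 1 (-1))) = m + 1"
    "int (card (char_class (-1) 1)) = m + 1" "int (card (char_class (-1) (-1))) = m + 1"
    using card_char_class[of 1 1] card_char_class[of 1 "-1"] card_char_class[of "-1" 1]
      card_char_class[of "-1" "-1"] q by simp_all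
  have "char_class 1 1 \<noteq> {}" "char_class 1 (-1) \<noteq> {}"
    using card m by auto
  then obtain t1 t2 where t12: "t1 \<in> char_class 1 1" "t2 \<in> char_class 1 (-1)" by blast
  define a where "a = cubic_sum t1"
  define b where "b = cubic_sum t2"
  have S1: "cubic_sum t = a" if "t \<in> char_class 1 1" for t
    unfolding a_def using const[OF that t12(1)] by simp
  have S2: "cubic_sum t = b" if "t \<in> char_class 1 (-1)" for t
    unfolding b_def using const[OF that t12(2)] by simp
  have S3: "cubic_sum t = b" if "t \<in> char_class (-1) 1" for t
    using S2[of "1 - t"] that cubic_sum_reflect[of t] by (simp add: char_class_def)
  \<comment> \<open>Inversion maps this class into \<open>char_class (-1) 1\<close> and multiplies
    \<open>cubic_sum\<close> by \<open>quad_char t = -1\<close>.\<close>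
  have S4: "cubic_sum t = - b" if t: "t \<in> char_class (-1) (-1)" for t
  proof -
    have "t \<noteq> 0" using t by (auto simp: char_class_def)
    have "1 - inverse t = - ((1 - t) / t)" using \<open>t \<noteq> 0\<close> by (simp add: field_simps)
    then have "quad_char (1 - inverse t) = quad_char (1 - t) * quad_char t"
      by (simp only: quad_char_uminus quad_char_divide)
    then have "inverse t \<in> char_class (-1) 1" using t by (simp add: char_class_def)
    from S3[OF this] show ?thesis
      using cubic_sum_inverse[OF \<open>t \<noteq> 0\<close>] t by (simp add: char_class_def)
  qed
  have sum_class: "sum (\<lambda>t. f (cubic_sum t)) (char_class e d) = int (card (char_class e d)) * f v"
    if "\<And>t. t \<in> char_class e d \<Longrightarrow> cubic_sum t = v" for e d v and f :: "int \<Rightarrow> int"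
    using that by simp
  \<comment> \<open>The last summand comes from \<open>t = 0\<close> and \<open>t = 1\<close>, where
    \<open>cubic_sum\<close> is -1.\<close>
  have sum_eq: "(\<Sum>t\<in>UNIV. f (cubic_sum t)) =
      m * f a + (m + 1) * f b + (m + 1) * f b + (m + 1) * f (- b) + 2 * f (-1)" for f :: "int \<Rightarrow> int"
    unfolding sum_remove_0_1 sum_char_classes
    by (simp add: sum_class[OF S1] sum_class[OF S2] sum_class[OF S3] sum_class[OF S4] card
        cubic_sum_0 cubic_sum_1)
  have e1: "a * m + b * (m + 1) = 2"
    using sum_eq[of "\<lambda>x. x"] sum_cubic_sum by (simp add: algebra_simps)
  have e2: "a\<^sup>2 * m + 3 * b\<^sup>2 * (m + 1) = (4 * m + 2) * (4 * m + 6)"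
    using sum_eq[of "\<lambda>x. x\<^sup>2"] sum_cubic_sum_square unfolding q
    by (simp add: algebra_simps power2_eq_square)
  \<comment> \<open>The equation \<open>e1\<close> reads \<open>k * m + b = 2\<close>, so the
    integer \<open>k\<close> parametrizes its solutions.\<close>
  define k where "k = a + b"
  have b: "b = 2 - k * m" and a: "a = k * (m + 1) - 2"
    using e1 by (simp_all add: k_def algebra_simps)
  have "m * (m + 1) * (k\<^sup>2 * (4 * m + 1) - 16 * (k + 1)) = 0"
    using e2 unfolding a b by (simp add: algebra_simps power2_eq_square)
  then have k: "k\<^sup>2 * (4 * m + 1) = 16 * (k + 1)" using m by simp
  have "k\<^sup>2 * 5 \<le> k\<^sup>2 * (4 * m + 1)"
    using m by (intro mult_left_mono) auto
  then have k_le: "k\<^sup>2 * 5 \<le> 16 * k + 16" using k by simp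
  have "k \<ge> 0"
  proof (rule ccontr)
    assume "\<not> k \<ge> 0"
    then have "k\<^sup>2 > 0" by simp
    with k_le \<open>\<not> k \<ge> 0\<close> show False by linarith
  qed
  moreover have "k \<le> 4"
  proof (rule ccontr)
    assume k5: "\<not> k \<le> 4"
    then have "5 * k \<le> k\<^sup>2" unfolding power2_eq_square by (intro mult_right_mono) auto
    with k_le have "9 * k \<le> 16" by linarith
    with k5 show False by linarith
  qed
  ultimately have "k = 0 \<or> k = 1 \<or> k = 2 \<or> k = 3 \<or> k = 4" by linarith
  \<comment> \<open>Only \<open>k = 4\<close> survives, with \<open>4 * m + 1 = 5\<close>. The value
    0 gives \<open>0 = 16\<close>, while 1, 2 and 3 would require \<open>4 * m + 1\<close> to be 32,
    12 and 64/9.\<close>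
  then have "m = 1" using k by (elim disjE) (simp_all, presburger+)
  then show ?thesis using q by simp
qed simp

subsection \<open>Paley graphs\<close>

lemma graph_rel_paley_eq_iff:
  "graph_rel paley x y = graph_rel paley x' y' \<longleftrightarrow> quad_char (x - y) = quad_char (x' - y' :: 'a)"
  using quad_char_cases[of "x - y"] quad_char_cases[of "x' - y'"]
  by (auto simp: graph_rel_def paley_iff)

lemma simple_graph_paley: "simple_graph (paley :: 'a \<Rightarrow> 'a \<Rightarrow> bool)"
  unfolding simple_graph_def
proof
  show "symp (paley :: 'a \<Rightarrow> 'a \<Rightarrow> bool)"
    using quad_char_diff_commute by (auto simp: symp_def paley_iff)
  show "irreflp (paley :: 'a \<Rightarrow> 'a \<Rightarrow> bool)"
    by (simp add: irreflp_def paley_iff)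
qed

text \<open>Apply triple regularity to the vertices \<open>w\<close>, \<open>w + 1\<close> and
  \<open>w + t\<close>. After translating \<open>w\<close> to 0, the common-neighbour count
  determines \<open>cubic_sum t\<close> within a class.\<close>

lemma triply_transitive_paley_imp:
  assumes "triply_transitive (paley :: 'a \<Rightarrow> 'a \<Rightarrow> bool)"
  shows "CARD('a) \<in> {5, 9}"
proof (rule cubic_sum_constant_on_classes)
  fix e d :: int and t t' :: 'a
  assume t: "t \<in> char_class e d" and t': "t' \<in> char_class e d" and ed: "e \<in> {1, -1}" "d \<in> {1, -1}"
  obtain w :: 'a where w: "terwilliger_T0 paley w = terwilliger_algebra paley w"
    using assms by (auto simp: triply_transitive_def)
  have count: "card {z. paley w z \<and> paley (w + 1) z \<and> paley (w + s) z} =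
      card {z. quad_char z = 1 \<and> quad_char (z - 1) = 1 \<and> quad_char (z - s) = 1}" for s
  proof (rule bij_betw_same_card)
    show "bij_betw (\<lambda>z. z - w) {z. paley w z \<and> paley (w + 1) z \<and> paley (w + s) z}
        {z. quad_char z = 1 \<and> quad_char (z - 1) = 1 \<and> quad_char (z - s) = 1}"
    proof (rule bij_betw_byWitness[where f' = "\<lambda>z. z + w"])
      have "quad_char (w - z) = quad_char (z - w)" "quad_char (w + 1 - z) = quad_char (z - w - 1)"
        "quad_char (w + s - z) = quad_char (z - w - s)" for z
        using quad_char_diff_commute[of w z] quad_char_diff_commute[of "w + 1" z]
          quad_char_diff_commute[of "w + s" z] by (simp_all add: diff_diff_eq)
      then show "(\<lambda>z. z - w) ` {z. paley w z \<and> paley (w + 1) z \<and> paley (w + s) z} \<subseteq>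
          {z. quad_char z = 1 \<and> quad_char (z - 1) = 1 \<and> quad_char (z - s) = 1}"
        and "(\<lambda>z. z + w) ` {z. quad_char z = 1 \<and> quad_char (z - 1) = 1 \<and> quad_char (z - s) = 1} \<subseteq>
          {z. paley w z \<and> paley (w + 1) z \<and> paley (w + s) z}"
        unfolding paley_iff by auto
    qed auto
  qed
  have "card {z. paley w z \<and> paley (w + 1) z \<and> paley (w + t) z} =
      card {z. paley w z \<and> paley (w + 1) z \<and> paley (w + t') z}"
  proof (rule triply_regular_count[OF simple_graph_paley w])
    show "graph_rel paley (w + 1) (w + t) = graph_rel paley (w + 1) (w + t')"
      "graph_rel paley w (w + t) = graph_rel paley w (w + t')"
      unfolding graph_rel_paley_eq_iff using t t' by (simp_all add: char_class_def)
  qed simp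
  moreover have "t \<noteq> 0" "t \<noteq> 1" "t' \<noteq> 0" "t' \<noteq> 1"
    using t t' ed by (auto simp: char_class_def)
  ultimately show "cubic_sum t = cubic_sum t'"
    using card_common_square_shifts[of t] card_common_square_shifts[of t'] t t'
    unfolding count by (simp add: char_class_def)
qed

section \<open>Affine automorphisms and strong regularity\<close>

lemma affine_aut_paley:
  assumes "quad_char a = 1"
  shows "(\<lambda>z. a * z + b) \<in> graph_aut (paley :: 'a \<Rightarrow> 'a \<Rightarrow> bool)"
proof -
  have a: "a \<noteq> 0" using assms by auto
  have "bij (\<lambda>z. a * z + b)"
    by (rule o_bij[where g = "\<lambda>z. (z - b) / a"]) (use a in \<open>auto simp: fun_eq_iff\<close>)
  moreover have "a * x + b - (a * y + b) = a * (x - y)" for x y by (simp add: algebra_simps)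
  ultimately show ?thesis
    using assms by (simp add: graph_aut_def paley_iff quad_char_mult)
qed

lemma vertex_transitive_paley: "vertex_transitive (paley :: 'a \<Rightarrow> 'a \<Rightarrow> bool)"
  unfolding vertex_transitive_def
proof (intro allI)
  fix x y :: 'a
  show "\<exists>g\<in>graph_aut paley. g x = y"
    by (rule bexI[OF _ affine_aut_paley[of 1 "y - x"]]) simp_all
qed

text \<open>No parameters are computed: affine maps with square slope carry \<open>(1, 0)\<close> to
  any adjacent pair and \<open>(n, 0)\<close> to any non-adjacent pair of distinct vertices.\<close>

lemma strongly_regular_paley: "strongly_regular (paley :: 'a \<Rightarrow> 'a \<Rightarrow> bool)"
proof -
  let ?P = "paley :: 'a \<Rightarrow> 'a \<Rightarrow> bool"
  have common: "card {z. ?P (g x) z \<and> ?P (g y) z} = card {z. ?P x z \<and> ?P y z}"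
    if g: "g \<in> graph_aut ?P" for g x y
  proof -
    have "{z. ?P (g x) z \<and> ?P (g y) z} = g ` {z. ?P x z \<and> ?P y z}"
    proof (intro equalityI subsetI)
      fix z assume z: "z \<in> {z. ?P (g x) z \<and> ?P (g y) z}"
      have "surj g" using g by (simp add: graph_aut_def bij_def)
      then obtain u where "z = g u" by (rule surjE)
      with z g show "z \<in> g ` {z. ?P x z \<and> ?P y z}" by (auto simp: graph_aut_def)
    qed (use g in \<open>auto simp: graph_aut_def\<close>)
    moreover have "inj g" using g by (simp add: graph_aut_def bij_def)
    ultimately show ?thesis by (simp add: card_image inj_on_subset)
  qed
  have affine: "card {z. ?P (a * x + b) z \<and> ?P (a * y + b) z} = card {z. ?P x z \<and> ?P y z}"
    if "quad_char a = 1" for a b x y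
    using common[OF affine_aut_paley[OF that]] .
  obtain n :: 'a where n: "quad_char n = -1" using ex_quad_char_minus_1 ..
  then have "n \<noteq> 0" by auto
  \<comment> \<open>A degree is the common-neighbour count of a vertex with itself.\<close>
  have "card {z. ?P x z} = card {z. ?P 0 z}" for x
    using affine[of 1 0 x 0] by simp
  moreover have "card {z. ?P x z \<and> ?P y z} = card {z. ?P 1 z \<and> ?P 0 z}" if "?P x y" for x y
    using affine[of "x - y" 1 y 0] that by (simp add: paley_iff)
  moreover have "card {z. ?P x z \<and> ?P y z} = card {z. ?P n z \<and> ?P 0 z}"
    if "x \<noteq> y \<and> \<not> ?P x y" for x y
  proof -
    have "quad_char ((x - y) / n) = 1"
      using that n quad_char_cases[of "x - y"] by (auto simp: paley_iff quad_char_divide)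
    from affine[OF this, of n y 0] show ?thesis using \<open>n \<noteq> 0\<close> by simp
  qed
  moreover have "?P 1 0" "n \<noteq> 0 \<and> \<not> ?P n 0" using n \<open>n \<noteq> 0\<close> by (simp_all add: paley_iff)
  ultimately show ?thesis
    unfolding strongly_regular_def using simple_graph_paley by blast
qed

text \<open>With base vertex 0 and \<open>x\<close> non-zero, scaling reduces a pair
  \<open>(x, y)\<close> to \<open>(1, t)\<close> with \<open>t = y / x\<close>. A
  character-preserving field automorphism taking \<open>t\<close> to \<open>t'\<close>, followed by
  a square scaling, then joins any two pairs in the same relations.\<close>

lemma triply_transitive_paleyI:
  assumes galois: "\<And>(t::'a) (t'::'a). t \<noteq> 0 \<Longrightarrow> t \<noteq> 1 \<Longrightarrow> quad_char t = quad_char t' \<Longrightarrow>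
      quad_char (1 - t) = quad_char (1 - t') \<Longrightarrow>
      \<exists>s. bij s \<and> (\<forall>x y. s (x - y) = s x - s y) \<and> (\<forall>x y. s (x * y) = s x * s y) \<and>
        (\<forall>x. quad_char (s x) = quad_char x) \<and> s t = t'"
  shows "triply_transitive (paley :: 'a \<Rightarrow> 'a \<Rightarrow> bool)"
proof (rule triply_transitiveI[OF strongly_regular_paley vertex_transitive_paley])
  fix x y x' y' :: 'a
  assume "graph_rel paley 0 x = graph_rel paley 0 x'" "graph_rel paley x y = graph_rel paley x' y'"
    "graph_rel paley 0 y = graph_rel paley 0 y'"
  then have x: "quad_char x = quad_char x'" and xy: "quad_char (x - y) = quad_char (x' - y')"
    and y: "quad_char y = quad_char y'"
    by (simp_all add: graph_rel_paley_eq_iff)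
  have x0: "x = 0 \<longleftrightarrow> x' = 0" and y0: "y = 0 \<longleftrightarrow> y' = 0" and eq: "x = y \<longleftrightarrow> x' = y'"
    using x y xy quad_char_eq_0_iff by (metis, metis, metis eq_iff_diff_eq_0)
  have scale: "(\<lambda>z. c * z) \<in> vertex_stabilizer paley 0" if "quad_char c = 1" for c :: 'a
    using affine_aut_paley[OF that, of 0] by (simp add: vertex_stabilizer_def)
  have ratio: "quad_char (u / v) = 1" if "quad_char u = quad_char v" "v \<noteq> 0" for u v :: 'a
    using that quad_char_square[of v] by (simp add: quad_char_divide)
  show "\<exists>g\<in>vertex_stabilizer paley 0. g x = x' \<and> g y = y'"
  proof (cases "x = 0")
    case True
    show ?thesis
    proof (cases "y = 0")
      case True
      then show ?thesis using \<open>x = 0\<close> x0 y0 scale[of 1] by auto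
    next
      case False
      then show ?thesis using True x0 y0 scale[OF ratio[of y' y]] y
        by (intro bexI[of _ "\<lambda>z. y' / y * z"]) auto
    qed
  next
    case False
    then have "x' \<noteq> 0" using x0 by simp
    define t where "t = y / x"
    define t' where "t' = y' / x'"
    have yt: "y = x * t" "y' = x' * t'" using False \<open>x' \<noteq> 0\<close> by (simp_all add: t_def t'_def)
    show ?thesis
    proof (cases "t = t'")
      case True
      then show ?thesis using False scale[OF ratio[of x' x]] x
        by (intro bexI[of _ "\<lambda>z. x' / x * z"]) (auto simp: yt)
    next
      case tt': False
      \<comment> \<open>If \<open>t\<close> were 0 or 1, the relations would force
        \<open>t' = t\<close>.\<close>
      have "t \<noteq> 0" "t \<noteq> 1"
        using tt' y0 eq yt False \<open>x' \<noteq> 0\<close> by auto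
      moreover have "quad_char t = quad_char t'"
        by (simp add: t_def t'_def quad_char_divide x y)
      moreover have "quad_char (1 - t) = quad_char (1 - t')"
      proof -
        have "1 - t = (x - y) / x" "1 - t' = (x' - y') / x'"
          using False \<open>x' \<noteq> 0\<close> by (simp_all add: t_def t'_def diff_divide_distrib)
        then show ?thesis by (simp only: quad_char_divide x xy)
      qed
      ultimately obtain s where s: "bij s" "\<And>x y. s (x - y) = s x - s y" "\<And>x y. s (x * y) = s x * s y"
        "\<And>x. quad_char (s x) = quad_char x" "s t = t'"
        using galois[of t t'] by blast
      have sx: "s x \<noteq> 0" using s(4)[of x] False by (metis quad_char_eq_0_iff)
      define a where "a = x' / s x"
      have a: "quad_char a = 1" unfolding a_def using s(4)[of x] x sx by (intro ratio) simp_all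
      \<comment> \<open>That \<open>s\<close> fixes 0 follows from
        \<open>s (0 - 0) = s 0 - s 0\<close>.\<close>
      have "s \<in> vertex_stabilizer paley 0"
        using s(1,4) s(2)[of 0 0] by (simp add: vertex_stabilizer_def graph_aut_def paley_iff flip: s(2))
      then have "(\<lambda>z. a * s z) \<in> vertex_stabilizer paley 0"
        using scale[OF a] bij_comp[of s "\<lambda>z. a * z"]
        by (simp add: vertex_stabilizer_def graph_aut_def o_def)
      moreover have "a * s x = x'" "a * s y = y'"
        using sx by (simp_all add: a_def yt s(3,5))
      ultimately show ?thesis by (intro bexI[of _ "\<lambda>z. a * s z"]) simp_all
    qed
  qed
qed

text \<open>Each class has at most one element, so the identity serves as the field
  automorphism.\<close>

lemma triply_transitive_paley_5:
  assumes "CARD('a) = 5"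
  shows "triply_transitive (paley :: 'a \<Rightarrow> 'a \<Rightarrow> bool)"
proof (rule triply_transitive_paleyI)
  fix t t' :: 'a
  assume t: "t \<noteq> 0" "t \<noteq> 1"
    and same: "quad_char t = quad_char t'" "quad_char (1 - t) = quad_char (1 - t')"
  define C where "C = char_class (quad_char t) (quad_char (1 - t))"
  have "quad_char t \<in> {1, -1}" "quad_char (1 - t) \<in> {1, -1}"
    using t quad_char_cases[of t] quad_char_cases[of "1 - t"] by auto
  then have "4 * int (card C) \<le> 4"
    unfolding C_def by (subst card_char_class) (auto simp: assms)
  then have "card C \<le> Suc 0" by simp
  moreover have "t \<in> C" "t' \<in> C" using same by (simp_all add: C_def char_class_def)
  ultimately have "t = t'" by (metis card_le_Suc0_iff_eq finite)
  then show "\<exists>s. bij s \<and> (\<forall>x y. s (x - y) = s x - s y) \<and> (\<forall>x y. s (x * y) = s x * s y) \<and>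
      (\<forall>x. quad_char (s x) = quad_char x) \<and> s t = t'"
    by (intro exI[of _ id]) auto
qed

text \<open>The class of sign pair (1, 1) is a singleton, and each other class is a two-element
  orbit of the Frobenius map \<open>x ^ 3\<close>.\<close>

lemma triply_transitive_paley_9:
  assumes card: "CARD('a) = 9"
  shows "triply_transitive (paley :: 'a \<Rightarrow> 'a \<Rightarrow> bool)"
proof (rule triply_transitive_paleyI)
  fix t t' :: 'a
  assume t: "t \<noteq> 0" "t \<noteq> 1"
    and same: "quad_char t = quad_char t'" "quad_char (1 - t) = quad_char (1 - t')"
  have "(3::'a) * 3 = 0" using of_nat_card_field[where 'a = 'a] by (simp add: card)
  then have three: "(3::'a) = 0" by (simp only: mult_eq_0_iff disj_absorb)
  have cube_diff: "(x - y) ^ 3 = x ^ 3 - y ^ 3" for x y :: 'a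
  proof -
    have "(x - y) ^ 3 = x ^ 3 - y ^ 3 - 3 * (x * x * y - x * y * y)"
      by (simp add: power3_eq_cube algebra_simps)
    then show ?thesis by (simp add: three)
  qed
  have cube_char: "quad_char (x ^ 3) = quad_char x" for x :: 'a
    using quad_char_cases[of x] by (auto simp: power3_eq_cube quad_char_mult)
  have "inj (\<lambda>x::'a. x ^ 3)"
  proof (rule injI)
    fix x y :: 'a assume "x ^ 3 = y ^ 3"
    then have "(x - y) ^ 3 = 0" by (simp add: cube_diff)
    then show "x = y" by simp
  qed
  then have cube_bij: "bij (\<lambda>x::'a. x ^ 3)" by (simp add: bij_def finite_UNIV_inj_surj)
  define C where "C = char_class (quad_char t) (quad_char (1 - t))"
  have tC: "t \<in> C" "t' \<in> C" using same by (simp_all add: C_def char_class_def)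
  have units: "quad_char t \<in> {1, -1}" "quad_char (1 - t) \<in> {1, -1}"
    using t quad_char_cases[of t] quad_char_cases[of "1 - t"] by auto
  have "t' = t \<or> t' = t ^ 3"
  proof (cases "quad_char t = 1 \<and> quad_char (1 - t) = 1")
    case True
    then have "4 * int (card C) = 4"
      unfolding C_def by (subst card_char_class) (auto simp: card)
    then have "card C \<le> Suc 0" by simp
    with tC show ?thesis by (metis card_le_Suc0_iff_eq finite)
  next
    case False
    \<comment> \<open>In characteristic 3 the element -1 belongs to \<open>char_class 1 1\<close>,
      excluded in this case. The fixed points of cubing are 0, 1 and -1, so \<open>t\<close> is
      moved.\<close>
    have "1 - (-1) = (-1 :: 'a)" using three by (simp add: eq_neg_iff_add_eq_0)
    then have "t \<noteq> -1" using False quad_char_neg_1 by metis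
    have "t ^ 3 \<noteq> t"
    proof
      assume "t ^ 3 = t"
      then have "t * (t - 1) * (t + 1) = 0" by (simp add: power3_eq_cube algebra_simps)
      then show False using t \<open>t \<noteq> -1\<close> by (simp add: add_eq_0_iff2)
    qed
    moreover have "t ^ 3 \<in> C"
      using cube_diff[of 1 t] cube_char[of "1 - t"] cube_char[of t] by (simp add: C_def char_class_def)
    moreover have "card C = 2"
    proof -
      have "4 * int (card C) = 8"
        unfolding C_def using units False by (subst card_char_class) (auto simp: card)
      then show ?thesis by simp
    qed
    ultimately have "{t, t ^ 3} = C"
      using tC by (intro card_subset_eq) auto
    then show ?thesis using tC by blast
  qed
  then show "\<exists>s. bij s \<and> (\<forall>x y. s (x - y) = s x - s y) \<and> (\<forall>x y. s (x * y) = s x * s y) \<and>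
      (\<forall>x. quad_char (s x) = quad_char x) \<and> s t = t'"
  proof
    assume "t' = t"
    then show ?thesis by (intro exI[of _ id]) auto
  next
    assume "t' = t ^ 3"
    then show ?thesis
      using cube_bij cube_diff cube_char
      by (intro exI[of _ "\<lambda>x. x ^ 3"]) (auto simp: power_mult_distrib)
  qed
qed

end

theorem theorem6p3:
  fixes q :: nat
  assumes "primepow q"
    and "[q = 1] (mod 4)"
    and "CARD('a::{field,finite}) = q"
  shows "triply_transitive (paley :: 'a \<Rightarrow> 'a \<Rightarrow> bool) \<longleftrightarrow> q \<in> {5, 9}"
proof -
  have "CARD('a) mod 4 = 1" using assms by (simp add: cong_def)
  then show ?thesis
    using triply_transitive_paley_imp[where 'a = 'a] triply_transitive_paley_5[where 'a = 'a]
      triply_transitive_paley_9[where 'a = 'a] assms(3) by blast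
qed

end
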